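(* Let $m$ and $k$ be positive integers. The self-conjugate $(2m, 2m+1,\ldots,2m+2k)$-core partitions are equinumerous with the self-conjugate $(2m+1,2m+2,\ldots,2m+2k+1)$-core partitions.
   Context: A partition is self-conjugate if its Young diagram is symmetric about the main diagonal. The hook length of a box is the number of boxes weakly to its right in its row plus those strictly below it in its column. A partition is a $t$-core if no box has hook length divisible by $t$, and a $(t_1,\ldots,t_r)$-core if it is a $t_i$-core for each $i$. *)

theory Defs
  imports Main "HOL-Library.Equipollence"
begin

(* A partition is the list of its parts in weakly decreasing order; the empty
   list is the partition of 0. *)
definition is_partition :: "nat list \<Rightarrow> bool" where
  "is_partition p \<longleftrightarrow> sorted_wrt (\<ge>) p \<and> (\<forall>x\<in>set p. 0 < x)"

(* Boxes are (row, column) pairs, both counted from 0, rows going downwards. *)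
definition young_diagram :: "nat list \<Rightarrow> (nat \<times> nat) set" where
  "young_diagram p = {(i, j). i < length p \<and> j < p ! i}"

definition self_conjugate :: "nat list \<Rightarrow> bool" where
  "self_conjugate p \<longleftrightarrow> prod.swap ` young_diagram p = young_diagram p"

definition hook_length :: "nat list \<Rightarrow> nat \<times> nat \<Rightarrow> nat" where
  "hook_length p b =
     card {c \<in> young_diagram p. fst c = fst b \<and> snd b \<le> snd c} +
     card {c \<in> young_diagram p. snd c = snd b \<and> fst b < fst c}"

definition is_core :: "nat \<Rightarrow> nat list \<Rightarrow> bool" where
  "is_core t p \<longleftrightarrow> (\<forall>b\<in>young_diagram p. \<not> t dvd hook_length p b)"

(* The self-conjugate (t_1, ..., t_r)-core partitions, of all sizes, where
   T = {t_1, ..., t_r}. *)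
definition self_conjugate_cores :: "nat set \<Rightarrow> nat list set" where
  "self_conjugate_cores T =
     {p. is_partition p \<and> self_conjugate p \<and> (\<forall>t\<in>T. is_core t p)}"

end

theory Submission imports Defs begin

text \<open>
  Encode a self-conjugate partition by the set \<open>D\<close> of the arms \<open>d\<close> of its diagonal boxes (so the
  diagonal hook lengths are \<open>2 d + 1\<close>). It is a \<open>t\<close>-core iff \<open>D\<close> is closed under subtraction of
  \<open>t\<close> and no \<open>d, d' \<in> D\<close> satisfy \<open>d + d' + 1 = t\<close>. When \<open>t\<close> ranges over
  \<open>2m + e, \<dots>, 2m + 2k + e\<close> with \<open>e \<le> 1\<close>, this confines \<open>D\<close> to blocks of consecutive numbers:
  block \<open>l\<close> has \<open>m - l k\<close> elements and starts at \<open>l (m + k) + e \<lceil>l/2\<rceil>\<close>. In terms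
  of the pairs (block, offset within the block) the conditions do not depend on \<open>e\<close>, so moving the
  blocks is the desired bijection between \<open>e = 0\<close> and \<open>e = 1\<close>.
\<close>

section \<open>Beta sets\<close>

text \<open>Rows past the last part count as empty, so every natural number indexes a row.\<close>

definition row_length :: "nat list \<Rightarrow> nat \<Rightarrow> nat" where
  "row_length p i = (if i < length p then p ! i else 0)"

text \<open>For a partition this is part \<open>j\<close> of the conjugate; the minimum exists
  because rows past the end are empty.\<close>

definition col_length :: "nat list \<Rightarrow> nat \<Rightarrow> nat" where
  "col_length p j = (LEAST i. row_length p i \<le> j)"

text \<open>The Maya diagram of charge 0: the labels of the vertical steps of the boundary path. The
  empty rows contribute all sufficiently small integers.\<close>

definition beta_set :: "nat list \<Rightarrow> int set" where
  "beta_set p = range (\<lambda>i. int (row_length p i) - int i - 1)"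

lemma mem_young_diagram_iff: "(i, j) \<in> young_diagram p \<longleftrightarrow> j < row_length p i"
  by (auto simp: young_diagram_def row_length_def)

lemma row_length_antimono:
  assumes "is_partition p" and "i \<le> i'"
  shows "row_length p i' \<le> row_length p i"
  using assms unfolding is_partition_def row_length_def sorted_wrt_iff_nth_less
  by (cases "i = i'") auto

lemma less_row_length_iff:
  assumes "is_partition p"
  shows "j < row_length p i \<longleftrightarrow> i < col_length p j"
proof
  have "row_length p (length p) \<le> j"
    by (simp add: row_length_def)
  then have least: "row_length p (col_length p j) \<le> j"
    unfolding col_length_def by (rule LeastI)
  show "i < col_length p j" if "j < row_length p i"
  proof (rule ccontr)
    assume "\<not> i < col_length p j"
    then have "row_length p i \<le> row_length p (col_length p j)"
      using assms by (intro row_length_antimono) auto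
    with least that show False by simp
  qed
  show "j < row_length p i" if "i < col_length p j"
    using that not_less_Least unfolding col_length_def by (metis not_le)
qed

text \<open>Every integer labels exactly one step of the boundary path: rows give the vertical
  steps, columns the horizontal ones, so the gaps of the beta set are indexed by columns.\<close>

lemma notin_beta_set_iff:
  assumes p: "is_partition p"
  shows "x \<notin> beta_set p \<longleftrightarrow> (\<exists>j. x = int j - int (col_length p j))"
proof
  assume "\<exists>j. x = int j - int (col_length p j)"
  then obtain j where j: "x = int j - int (col_length p j)" ..
  show "x \<notin> beta_set p"
  proof
    assume "x \<in> beta_set p"
    then obtain i where i: "x = int (row_length p i) - int i - 1"
      by (auto simp: beta_set_def)
    show False
      using i j less_row_length_iff[OF p, of j i] by (cases "j < row_length p i") auto
  qed
next
  assume x: "x \<notin> beta_set p"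
  \<comment> \<open>Walk down to the first row \<open>i\<close> whose beta number is at most
    \<open>x\<close>. Column \<open>x + i\<close> then has length exactly \<open>i\<close>: row
    \<open>i\<close> is too short to reach it, while the row above does reach it.\<close>
  define P where "P i \<longleftrightarrow> int (row_length p i) - int i - 1 \<le> x" for i
  have "P (length p + nat (- x))"
    by (auto simp: P_def row_length_def)
  define i where "i = (LEAST i. P i)"
  have "P i"
    unfolding i_def by (rule LeastI) fact
  moreover have "int (row_length p i) - int i - 1 \<noteq> x"
    using x by (auto simp: beta_set_def)
  ultimately have lt: "int (row_length p i) - int i - 1 < x"
    by (simp add: P_def)
  define j where "j = nat (x + int i)"
  have j: "int j = x + int i"
    using lt by (simp add: j_def)
  have "\<not> i < col_length p j"
    using lt j less_row_length_iff[OF p, of j i] by linarith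
  moreover have "i \<le> col_length p j"
  proof (cases i)
    case (Suc i')
    then have "\<not> P i'"
      unfolding i_def using not_less_Least by (metis lessI)
    then have "j < row_length p i'"
      using j Suc by (simp add: P_def)
    then show ?thesis
      using less_row_length_iff[OF p, of j i'] Suc by simp
  qed simp
  ultimately have "x = int j - int (col_length p j)"
    using j by simp
  then show "\<exists>j. x = int j - int (col_length p j)" ..
qed

section \<open>Hook lengths and cores in terms of beta numbers\<close>

text \<open>The arm counted with the box and the leg add up to a beta number minus a gap.\<close>

lemma hook_length_eq:
  assumes p: "is_partition p" and box: "(i, j) \<in> young_diagram p"
  shows "int (hook_length p (i, j))
    = (int (row_length p i) - int i - 1) - (int j - int (col_length p j))"
proof -
  have "{c \<in> young_diagram p. fst c = i \<and> j \<le> snd c} = Pair i ` {j..<row_length p i}"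
    by (auto simp: mem_young_diagram_iff)
  then have arm: "card {c \<in> young_diagram p. fst c = i \<and> j \<le> snd c} = row_length p i - j"
    by (simp add: card_image inj_on_def)
  have "{c \<in> young_diagram p. snd c = j \<and> i < fst c} = (\<lambda>i'. (i', j)) ` {i<..<col_length p j}"
    by (auto simp: mem_young_diagram_iff less_row_length_iff[OF p])
  then have leg: "card {c \<in> young_diagram p. snd c = j \<and> i < fst c} = col_length p j - Suc i"
    by (simp add: card_image inj_on_def)
  have "j < row_length p i" "i < col_length p j"
    using box by (simp_all add: mem_young_diagram_iff less_row_length_iff[OF p, symmetric])
  then show ?thesis
    by (simp add: hook_length_def arm leg)
qed

text \<open>If \<open>x\<close> is a beta number and \<open>x - t\<close> a gap, their row and
  column meet in a box of hook length \<open>t\<close>. Conversely, a hook length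
  \<open>n * t\<close> joins a beta number \<open>x\<close> to a gap \<open>x - n * t\<close>, which
  closure under subtracting \<open>t\<close> rules out.\<close>

lemma is_core_iff:
  assumes p: "is_partition p" and t: "0 < t"
  shows "is_core t p \<longleftrightarrow> (\<forall>x\<in>beta_set p. x - int t \<in> beta_set p)"
proof
  assume core: "is_core t p"
  show "\<forall>x\<in>beta_set p. x - int t \<in> beta_set p"
  proof (rule ballI, rule ccontr)
    fix x
    assume "x \<in> beta_set p" and "x - int t \<notin> beta_set p"
    obtain i where i: "x = int (row_length p i) - int i - 1"
      using \<open>x \<in> beta_set p\<close> by (auto simp: beta_set_def)
    obtain j where j: "x - int t = int j - int (col_length p j)"
      using \<open>x - int t \<notin> beta_set p\<close> notin_beta_set_iff[OF p] by blast
    \<comment> \<open>A box outside the diagram would put the beta number of its row below the gap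
      of its column, but here the difference is \<open>t > 0\<close>.\<close>
    have box: "(i, j) \<in> young_diagram p"
      using i j t less_row_length_iff[OF p, of j i] unfolding mem_young_diagram_iff by linarith
    then have "int (hook_length p (i, j)) = int t"
      using i j by (simp add: hook_length_eq[OF p])
    then show False
      using core box by (auto simp: is_core_def)
  qed
next
  assume closed: "\<forall>x\<in>beta_set p. x - int t \<in> beta_set p"
  have iter: "x - int n * int t \<in> beta_set p" if "x \<in> beta_set p" for x n
  proof (induction n)
    case (Suc n)
    then have "x - int n * int t - int t \<in> beta_set p"
      using closed by blast
    then show ?case
      by (simp add: algebra_simps)
  qed (use that in simp)
  have "\<not> t dvd hook_length p (i, j)" if box: "(i, j) \<in> young_diagram p" for i j
  proof
    assume "t dvd hook_length p (i, j)"
    then obtain n where n: "hook_length p (i, j) = n * t"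
      by (metis dvdE mult.commute)
    define x where "x = int (row_length p i) - int i - 1"
    have "x - int n * int t = int j - int (col_length p j)"
      using hook_length_eq[OF p box] n by (simp add: x_def)
    then have "x - int n * int t \<notin> beta_set p"
      using notin_beta_set_iff[OF p] by blast
    moreover have "x \<in> beta_set p"
      by (auto simp: x_def beta_set_def)
    ultimately show False
      using iter by blast
  qed
  then show "is_core t p"
    by (auto simp: is_core_def)
qed

section \<open>Recovering a partition from its beta set, and conjugation as a reflection\<close>

lemma beta_strict_antimono:
  assumes "is_partition p" and "i < j"
  shows "int (row_length p j) - int j - 1 < int (row_length p i) - int i - 1"
  using row_length_antimono[OF assms(1), of i j] assms(2) by simp

text \<open>The value \<open>g i\<close> equals some \<open>f j\<close>, and \<open>j < i\<close> is
  excluded because those values are already taken by \<open>g\<close> at smaller arguments; so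
  \<open>g i = f j\<close> is at most \<open>f i\<close>.\<close>

lemma strict_antimono_range_le:
  fixes f g :: "nat \<Rightarrow> int"
  assumes f: "\<And>i j. i < j \<Longrightarrow> f j < f i" and g: "\<And>i j. i < j \<Longrightarrow> g j < g i"
    and ran: "range f = range g" and prev: "\<And>j. j < i \<Longrightarrow> f j = g j"
  shows "g i \<le> f i"
proof -
  obtain j where j: "g i = f j"
    using ran by (metis rangeE rangeI)
  then have "\<not> j < i"
    using prev g by fastforce
  then show ?thesis
    using f[of i j] j by (cases "i = j") auto
qed

lemma strict_antimono_range_eq:
  fixes f g :: "nat \<Rightarrow> int"
  assumes f: "\<And>i j. i < j \<Longrightarrow> f j < f i" and g: "\<And>i j. i < j \<Longrightarrow> g j < g i"
    and ran: "range f = range g"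
  shows "f i = g i"
proof (induction i rule: less_induct)
  case (less i)
  show ?case
    using strict_antimono_range_le[of f g i, OF f g ran less]
      strict_antimono_range_le[of g f i, OF g f ran[symmetric] less[symmetric]] by simp
qed

text \<open>The beta numbers in row order are the decreasing enumeration of their set, so the set
  determines all row lengths. Since parts are positive, these also determine the length of the
  list.\<close>

lemma beta_set_inj:
  assumes p: "is_partition p" and q: "is_partition q" and eq: "beta_set p = beta_set q"
  shows "p = q"
proof -
  have row: "row_length p i = row_length q i" for i
    using strict_antimono_range_eq[of "\<lambda>i. int (row_length p i) - int i - 1"
        "\<lambda>i. int (row_length q i) - int i - 1" i,
        OF beta_strict_antimono[OF p] beta_strict_antimono[OF q] eq[unfolded beta_set_def]]
    by simp
  have pos: "i < length r \<longleftrightarrow> 0 < row_length r i" if "is_partition r" for r i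
    using that by (auto simp: row_length_def is_partition_def)
  have "i < length p \<longleftrightarrow> i < length q" for i
    using pos[OF p] pos[OF q] row by simp
  then have len: "length p = length q"
    by (metis less_irrefl_nat linorder_neqE_nat)
  show ?thesis
  proof (rule nth_equalityI[OF len])
    show "p ! i = q ! i" if "i < length p" for i
      using row[of i] len that by (simp add: row_length_def)
  qed
qed

text \<open>Transposing the diagram reflects the boundary path: \<open>x\<close> goes to
  \<open>- 1 - x\<close>, and beta numbers trade places with gaps. For the converse, rows and
  columns then enumerate the same set in decreasing order.\<close>

lemma self_conjugate_iff:
  assumes p: "is_partition p"
  shows "self_conjugate p \<longleftrightarrow> (\<forall>x. x \<in> beta_set p \<longleftrightarrow> - 1 - x \<notin> beta_set p)"
proof -
  have "self_conjugate p \<longleftrightarrow> (\<forall>i j. (i, j) \<in> young_diagram p \<longleftrightarrow> (j, i) \<in> young_diagram p)"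
    unfolding self_conjugate_def
    by (metis (no_types, lifting) image_iff pair_in_swap_image subsetI subset_antisym surj_pair)
  also have "\<dots> \<longleftrightarrow> (\<forall>i j. j < row_length p i \<longleftrightarrow> j < col_length p i)"
    unfolding mem_young_diagram_iff less_row_length_iff[OF p] by blast
  also have "\<dots> \<longleftrightarrow> (\<forall>i. row_length p i = col_length p i)"
    by (metis less_irrefl_nat linorder_neqE_nat)
  also have "\<dots> \<longleftrightarrow> (\<forall>x. x \<in> beta_set p \<longleftrightarrow> - 1 - x \<notin> beta_set p)"
  proof
    assume rc: "\<forall>i. row_length p i = col_length p i"
    have "x \<in> beta_set p \<longleftrightarrow> (\<exists>j. - 1 - x = int j - int (col_length p j))" for x
    proof -
      have "x = int (row_length p j) - int j - 1 \<longleftrightarrow> - 1 - x = int j - int (col_length p j)" for j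
        using rc by auto
      then show ?thesis
        by (simp add: beta_set_def image_iff)
    qed
    then show "\<forall>x. x \<in> beta_set p \<longleftrightarrow> - 1 - x \<notin> beta_set p"
      unfolding notin_beta_set_iff[OF p] by blast
  next
    assume sym: "\<forall>x. x \<in> beta_set p \<longleftrightarrow> - 1 - x \<notin> beta_set p"
    have "x \<in> beta_set p \<longleftrightarrow> x \<in> range (\<lambda>j. int (col_length p j) - int j - 1)" for x
    proof -
      have "- 1 - x = int j - int (col_length p j) \<longleftrightarrow> x = int (col_length p j) - int j - 1" for j
        by auto
      then show ?thesis
        unfolding sym[rule_format, of x] notin_beta_set_iff[OF p] image_iff by simp
    qed
    then have ran: "range (\<lambda>i. int (row_length p i) - int i - 1)
        = range (\<lambda>j. int (col_length p j) - int j - 1)"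
      unfolding beta_set_def[symmetric] by blast
    have "col_length p j \<le> col_length p i" if "i < j" for i j
      using less_row_length_iff[OF p] that by (meson less_imp_le_nat not_le order.strict_trans1)
    then have "int (col_length p j) - int j - 1 < int (col_length p i) - int i - 1"
      if "i < j" for i j
      using that by fastforce
    then have "int (row_length p i) - int i - 1 = int (col_length p i) - int i - 1" for i
      by (intro strict_antimono_range_eq[OF beta_strict_antimono[OF p] _ ran])
    then show "\<forall>i. row_length p i = col_length p i"
      by simp
  qed
  finally show ?thesis .
qed

section \<open>Diagonal arms\<close>

text \<open>The beta number of row \<open>i\<close> is nonnegative exactly when the diagonal box of
  that row exists, and then it is the arm of that box.\<close>

definition diag_arms :: "nat list \<Rightarrow> nat set" where
  "diag_arms p = {d. int d \<in> beta_set p}"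

text \<open>The only set of integers with nonnegative part \<open>D\<close> whose complement is its
  image under the reflection of \<open>x\<close> to \<open>- 1 - x\<close>.\<close>

definition symmetric_beta :: "nat set \<Rightarrow> int set" where
  "symmetric_beta D = {x. if 0 \<le> x then nat x \<in> D else nat (- 1 - x) \<notin> D}"

lemma symmetric_beta_symmetric: "x \<in> symmetric_beta D \<longleftrightarrow> - 1 - x \<notin> symmetric_beta D"
  by (auto simp: symmetric_beta_def)

lemma beta_set_eq_symmetric_beta:
  assumes "is_partition p" and "self_conjugate p"
  shows "beta_set p = symmetric_beta (diag_arms p)"
proof (rule set_eqI)
  fix x
  have "x \<in> beta_set p \<longleftrightarrow> - 1 - x \<notin> beta_set p"
    using self_conjugate_iff[OF assms(1)] assms(2) by blast
  then show "x \<in> beta_set p \<longleftrightarrow> x \<in> symmetric_beta (diag_arms p)"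
    by (cases "0 \<le> x") (simp_all add: symmetric_beta_def diag_arms_def del: not_le)
qed

lemma finite_diag_arms:
  assumes "is_partition p"
  shows "finite (diag_arms p)"
proof (rule finite_subset)
  show "diag_arms p \<subseteq> {..row_length p 0}"
  proof
    fix d assume "d \<in> diag_arms p"
    then obtain i where "int d = int (row_length p i) - int i - 1"
      by (auto simp: diag_arms_def beta_set_def)
    then show "d \<in> {..row_length p 0}"
      using row_length_antimono[OF assms, of 0 i] by simp
  qed
qed simp

text \<open>Adding a largest element \<open>d\<close> to the set of arms wraps a hook of length \<open>2 d + 1\<close> around the
  diagram; the bound on the length makes room for its leg.\<close>

lemma exists_partition_symmetric_beta:
  assumes "finite D"
  shows "\<exists>p. is_partition p \<and> beta_set p = symmetric_beta D
    \<and> (\<forall>b. D \<subseteq> {..<b} \<longrightarrow> length p \<le> b)"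
  using assms
proof (induction D rule: finite_linorder_max_induct)
  case empty
  have "beta_set [] = symmetric_beta {}"
  proof (rule set_eqI)
    fix x
    show "x \<in> beta_set [] \<longleftrightarrow> x \<in> symmetric_beta {}"
      by (auto simp: beta_set_def row_length_def symmetric_beta_def intro: image_eqI[of _ _ "nat (- 1 - x)"])
  qed
  then show ?case
    by (intro exI[of _ "[]"]) (simp add: is_partition_def)
next
  case (insert d D)
  then obtain q where q: "is_partition q" "beta_set q = symmetric_beta D" "length q \<le> d"
    by (metis lessThan_iff subsetI)
  \<comment> \<open>The old diagram moves one step down and right; ones extend the first column to
    height \<open>d + 1\<close>, the length of the new first row.\<close>
  define p where "p = Suc d # map Suc q @ replicate (d - length q) 1"
  have row0: "row_length p 0 = Suc d"
    by (simp add: p_def row_length_def)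
  have row: "row_length p (Suc i) = (if i < d then Suc (row_length q i) else 0)" for i
    using q(3) by (auto simp: p_def row_length_def nth_append)
  have "x \<le> d" if "x \<in> set q" for x
  proof -
    \<comment> \<open>The beta number of the top row is either negative, so that the row is empty,
      or an element of \<open>D\<close> and hence below \<open>d\<close>.\<close>
    have "row_length q 0 \<le> d"
    proof -
      have "int (row_length q 0) - 1 \<in> symmetric_beta D"
        unfolding q(2)[symmetric] by (auto simp: beta_set_def intro: image_eqI[of _ _ 0])
      then show ?thesis
        using insert.hyps(2) by (fastforce simp: symmetric_beta_def split: if_splits)
    qed
    then show ?thesis
      using that row_length_antimono[OF q(1), of 0] unfolding in_set_conv_nth
      by (metis le_trans row_length_def zero_le)
  qed
  moreover have "sorted_wrt (\<ge>) (map Suc q)" "sorted_wrt (\<ge>) (replicate (d - length q) (1::nat))"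
    using q(1) by (simp_all add: is_partition_def sorted_wrt_map sorted_wrt_iff_nth_less)
  ultimately have part: "is_partition p"
    by (auto simp: p_def is_partition_def sorted_wrt_append)
  \<comment> \<open>The hook inserts \<open>d\<close> and removes \<open>- d - 1\<close>. Row
    \<open>i < d\<close> of \<open>q\<close> keeps its beta number as row \<open>i + 1\<close> of
    \<open>p\<close>; the empty row \<open>d\<close> of \<open>q\<close> is the one lost, and beyond
    it both partitions have empty rows.\<close>
  have "x \<in> beta_set p \<longleftrightarrow> x = int d \<or> x \<in> beta_set q \<and> x \<noteq> - int d - 1" for x
  proof -
    have split: "(\<exists>i. Q i) \<longleftrightarrow> Q 0 \<or> (\<exists>i. Q (Suc i))" for Q :: "nat \<Rightarrow> bool"
      by (metis not0_implies_Suc)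
    have shift: "(\<exists>i\<ge>d. Q (Suc i)) \<longleftrightarrow> (\<exists>i>d. Q i)" for Q :: "nat \<Rightarrow> bool"
      by (metis Suc_le_D Suc_le_eq Suc_le_mono)
    have row_d: "row_length q i = 0" if "d \<le> i" for i
      using q(3) that by (simp add: row_length_def)
    have "x \<in> beta_set p \<longleftrightarrow> x = int (row_length p 0) - int 0 - 1
        \<or> (\<exists>i. x = int (row_length p (Suc i)) - int (Suc i) - 1)"
      unfolding beta_set_def image_iff bex_UNIV by (rule split)
    also have "\<dots> \<longleftrightarrow> x = int d \<or> (\<exists>i<d. x = int (row_length q i) - int i - 1)
        \<or> (\<exists>i\<ge>d. x = - int (Suc i) - 1)"
    proof -
      have "x = int (row_length p (Suc i)) - int (Suc i) - 1
          \<longleftrightarrow> i < d \<and> x = int (row_length q i) - int i - 1 \<or> d \<le> i \<and> x = - int (Suc i) - 1" for i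
        by (cases "i < d") (simp_all add: row)
      then show ?thesis
        unfolding row0 by auto
    qed
    also have "(\<exists>i\<ge>d. x = - int (Suc i) - 1) \<longleftrightarrow> (\<exists>i>d. x = int (row_length q i) - int i - 1)"
      unfolding shift[of "\<lambda>i. x = - int i - 1"] using row_d by auto
    also have "x = int d \<or> (\<exists>i<d. x = int (row_length q i) - int i - 1)
        \<or> (\<exists>i>d. x = int (row_length q i) - int i - 1)
      \<longleftrightarrow> x = int d \<or> x \<in> beta_set q \<and> x \<noteq> - int d - 1"
    proof -
      have "x \<in> beta_set q \<longleftrightarrow> (\<exists>i<d. x = int (row_length q i) - int i - 1)
          \<or> x = - int d - 1 \<or> (\<exists>i>d. x = int (row_length q i) - int i - 1)"
      proof -
        have "(\<exists>i. Q i) \<longleftrightarrow> (\<exists>i<d. Q i) \<or> Q d \<or> (\<exists>i>d. Q i)" for Q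
          by (metis linorder_neqE_nat)
        from this[of "\<lambda>i. x = int (row_length q i) - int i - 1"] show ?thesis
          by (simp add: beta_set_def image_iff row_d)
      qed
      moreover have "x \<noteq> - int d - 1"
        if "x = int (row_length q i) - int i - 1" "i < d \<or> d < i" for i
        using that row_d[of d] beta_strict_antimono[OF q(1), of i d]
          beta_strict_antimono[OF q(1), of d i] by auto
      ultimately show ?thesis
        by blast
    qed
    finally show ?thesis .
  qed
  then have "beta_set p = symmetric_beta (insert d D)"
    unfolding q(2) using insert.hyps(2) by (auto simp: symmetric_beta_def split: if_splits)
  moreover have "length p \<le> b" if "insert d D \<subseteq> {..<b}" for b
    using that q(3) by (auto simp: p_def)
  ultimately show ?case
    using part by blast
qed

section \<open>The core condition on sets of diagonal arms\<close>

definition core_arms :: "nat \<Rightarrow> nat set \<Rightarrow> bool" where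
  "core_arms t D \<longleftrightarrow> (\<forall>d\<in>D. t \<le> d \<longrightarrow> d - t \<in> D) \<and> (\<forall>d\<in>D. \<forall>d'\<in>D. d + d' + 1 \<noteq> t)"

text \<open>If \<open>x\<close> and \<open>x - t\<close> are both nonnegative, closure is the first
  clause of \<open>core_arms\<close>; if both are negative, it is the contrapositive of that clause
  after reflection. If subtraction crosses zero, \<open>x - t\<close> reflects to
  \<open>t - 1 - x\<close>, which gives the second clause.\<close>

lemma symmetric_beta_closed_iff:
  "(\<forall>x\<in>symmetric_beta D. x - int t \<in> symmetric_beta D) \<longleftrightarrow> core_arms t D"
proof
  assume closed: "\<forall>x\<in>symmetric_beta D. x - int t \<in> symmetric_beta D"
  show "core_arms t D"
    unfolding core_arms_def
  proof (intro conjI ballI impI notI)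
    fix d assume "d \<in> D" "t \<le> d"
    then show "d - t \<in> D"
      using closed[rule_format, of "int d"] by (simp add: symmetric_beta_def nat_diff_distrib)
  next
    fix d d' assume "d \<in> D" "d' \<in> D" "d + d' + 1 = t"
    then show False
      using closed[rule_format, of "int d"] by (auto simp: symmetric_beta_def)
  qed
next
  assume core: "core_arms t D"
  show "\<forall>x\<in>symmetric_beta D. x - int t \<in> symmetric_beta D"
  proof
    fix x assume x: "x \<in> symmetric_beta D"
    consider "int t \<le> x" | "0 \<le> x" "x < int t" | "x < 0" by linarith
    then show "x - int t \<in> symmetric_beta D"
    proof cases
      case 1
      then have "nat x \<in> D" "t \<le> nat x" using x by (auto simp: symmetric_beta_def)
      then have "nat x - t \<in> D" using core by (auto simp: core_arms_def)
      then show ?thesis using 1 by (simp add: symmetric_beta_def nat_diff_distrib)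
    next
      case 2
      then have "nat x \<in> D" using x by (auto simp: symmetric_beta_def)
      moreover have "nat x + nat (- 1 - (x - int t)) + 1 = t" using 2 by linarith
      ultimately have "nat (- 1 - (x - int t)) \<notin> D" using core by (auto simp: core_arms_def)
      then show ?thesis using 2 by (simp add: symmetric_beta_def)
    next
      case 3
      then have "nat (- 1 - x) \<notin> D" using x by (auto simp: symmetric_beta_def)
      moreover have "nat (- 1 - (x - int t)) - t = nat (- 1 - x)" "t \<le> nat (- 1 - (x - int t))"
        using 3 by linarith+
      ultimately have "nat (- 1 - (x - int t)) \<notin> D" using core by (metis core_arms_def)
      then show ?thesis using 3 by (simp add: symmetric_beta_def)
    qed
  qed
qed

lemma self_conjugate_cores_eqpoll:
  assumes "0 \<notin> T"
  shows "self_conjugate_cores T \<approx> {D. finite D \<and> (\<forall>t\<in>T. core_arms t D)}"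
proof -
  have core: "is_core t p \<longleftrightarrow> core_arms t (diag_arms p)"
    if "is_partition p" "self_conjugate p" "t \<in> T" for p t
    using that assms is_core_iff[of p t] beta_set_eq_symmetric_beta[of p]
      symmetric_beta_closed_iff[of "diag_arms p" t] by (metis gr0I)
  have "bij_betw diag_arms (self_conjugate_cores T) {D. finite D \<and> (\<forall>t\<in>T. core_arms t D)}"
  proof (rule bij_betw_imageI)
    show "inj_on diag_arms (self_conjugate_cores T)"
    proof (rule inj_onI)
      fix p q
      assume "p \<in> self_conjugate_cores T" "q \<in> self_conjugate_cores T" "diag_arms p = diag_arms q"
      then show "p = q"
        using beta_set_inj[of p q] beta_set_eq_symmetric_beta[of p] beta_set_eq_symmetric_beta[of q]
        by (simp add: self_conjugate_cores_def)
    qed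
    show "diag_arms ` self_conjugate_cores T = {D. finite D \<and> (\<forall>t\<in>T. core_arms t D)}"
    proof (intro equalityI subsetI)
      fix D assume "D \<in> diag_arms ` self_conjugate_cores T"
      then show "D \<in> {D. finite D \<and> (\<forall>t\<in>T. core_arms t D)}"
        using core finite_diag_arms by (auto simp: self_conjugate_cores_def)
    next
      fix D assume D: "D \<in> {D. finite D \<and> (\<forall>t\<in>T. core_arms t D)}"
      then have "finite D"
        by simp
      then obtain p where p: "is_partition p" "beta_set p = symmetric_beta D"
        using exists_partition_symmetric_beta[of D] by blast
      have sc: "self_conjugate p"
        unfolding self_conjugate_iff[OF p(1)] p(2) by (intro allI symmetric_beta_symmetric)
      have "diag_arms p = D"
        by (simp add: diag_arms_def p(2) symmetric_beta_def)
      then show "D \<in> diag_arms ` self_conjugate_cores T"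
        using D core p sc by (auto simp: self_conjugate_cores_def)
    qed
  qed
  then show ?thesis
    by (auto simp: eqpoll_def)
qed

section \<open>Blocks\<close>

definition block_pos :: "nat \<Rightarrow> nat \<Rightarrow> nat \<Rightarrow> nat \<times> nat \<Rightarrow> nat" where
  "block_pos m k e = (\<lambda>(l, j). l * (m + k) + e * ((l + 1) div 2) + j)"

definition block_index :: "nat \<Rightarrow> nat \<Rightarrow> (nat \<times> nat) set" where
  "block_index m k = {(l, j). l * k + j < m}"

text \<open>The second clause encodes subtraction of every modulus from an element of block 2 or
  higher. The third encodes the forbidden sums of an element of block 0 and one of block 1; block 1
  starts at \<open>m + k + e\<close>, so \<open>e\<close> cancels against the bounds on the
  moduli.\<close>

definition admissible :: "nat \<Rightarrow> nat \<Rightarrow> (nat \<times> nat) set \<Rightarrow> bool" where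
  "admissible m k E \<longleftrightarrow> E \<subseteq> block_index m k
     \<and> (\<forall>l j. (l + 2, j) \<in> E \<longrightarrow> (\<forall>i\<le>2 * k. (l, j + i) \<in> E))
     \<and> (\<forall>i j. (0, i) \<in> E \<longrightarrow> (1, j) \<in> E \<longrightarrow> \<not> (m \<le> i + j + 1 + k \<and> i + j + 1 \<le> m + k))"

text \<open>Two blocks up amounts to adding the largest modulus. Subtracting a modulus smaller by
  \<open>i\<close> therefore goes two blocks down and shifts the offset by \<open>i\<close>.\<close>

lemma block_pos_add2: "block_pos m k e (l + 2, j) = block_pos m k e (l, j) + (2 * m + 2 * k + e)"
  by (simp add: block_pos_def algebra_simps)

lemma block_pos_start_mono:
  assumes "l \<le> l'"
  shows "block_pos m k e (l, 0) \<le> block_pos m k e (l', 0)"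
  using assms by (auto simp: block_pos_def intro!: add_mono mult_le_mono div_le_mono)

text \<open>At least \<open>k\<close> integers separate consecutive blocks, so two consecutive
  integers never lie in different blocks.\<close>

lemma block_pos_less_next:
  assumes "(l, j) \<in> block_index m k" and "0 < k"
  shows "block_pos m k e (l, j) + 1 < block_pos m k e (l + 1, 0)"
proof -
  have "e * ((l + 1) div 2) \<le> e * ((l + 2) div 2)"
    by (intro mult_le_mono div_le_mono) auto
  then show ?thesis
    using assms by (auto simp: block_pos_def block_index_def algebra_simps)
qed

text \<open>The case \<open>i = 0\<close> yields injectivity; the case \<open>i = 1\<close> keeps a
  run of consecutive integers inside one block.\<close>

lemma block_pos_eqD:
  assumes L: "(l, j) \<in> block_index m k" "(l', j') \<in> block_index m k" and k: "0 < k"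
    and eq: "block_pos m k e (l', j') = block_pos m k e (l, j) + i" and i: "i \<le> 1"
  shows "l' = l \<and> j' = j + i"
proof -
  have offset: "block_pos m k e (a, b) = block_pos m k e (a, 0) + b" for a b
    by (simp add: block_pos_def)
  have "\<not> l < l'"
    using block_pos_less_next[OF L(1) k, of e] block_pos_start_mono[of "l + 1" l' m k e] eq i
      offset[of l' j'] by auto
  moreover have "\<not> l' < l"
    using block_pos_less_next[OF L(2) k, of e] block_pos_start_mono[of "l' + 1" l m k e] eq
      offset[of l j] by auto
  ultimately show ?thesis
    using eq offset[of l j] offset[of l' j'] by auto
qed

lemma inj_on_block_pos:
  assumes "0 < k"
  shows "inj_on (block_pos m k e) (block_index m k)"
  using block_pos_eqD[OF _ _ assms, of _ _ m _ _ e 0] by (auto intro!: inj_onI)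

lemma finite_block_index:
  assumes "0 < k"
  shows "finite (block_index m k)"
proof (rule finite_subset)
  have "l < m \<and> j < m" if "l * k + j < m" for l j
    using that assms by (metis One_nat_def Suc_leI add_lessD1 add.commute le_less_trans mult.right_neutral mult_le_mono2)
  then show "block_index m k \<subseteq> {..<m} \<times> {..<m}"
    by (auto simp: block_index_def)
qed simp

section \<open>Arm sets of cores correspond to admissible index sets\<close>

lemma core_arms_subset_blocks:
  assumes m: "0 < m" and k: "0 < k" and e: "e \<le> 1"
    and core: "\<forall>t\<in>{2*m + e..2*m + 2*k + e}. core_arms t D"
  shows "D \<subseteq> block_pos m k e ` block_index m k"
proof
  have sub: "d - t \<in> D" if "d \<in> D" "2*m + e \<le> t" "t \<le> 2*m + 2*k + e" "t \<le> d" for d t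
    using core that by (auto simp: core_arms_def)
  have add: "d + d' + 1 < 2*m + e \<or> 2*m + 2*k + e < d + d' + 1" if "d \<in> D" "d' \<in> D" for d d'
    using core[rule_format, of "d + d' + 1"] that by (fastforce simp: core_arms_def)
  fix d
  assume "d \<in> D"
  then show "d \<in> block_pos m k e ` block_index m k"
  proof (induction d rule: less_induct)
    case (less d)
    consider "d < m" | "m \<le> d" "d < m + k + e" | "m + k + e \<le> d" "d < 2*m + e"
      | "2*m + e \<le> d" "d < 2*m + 2*k + e" | "2*m + 2*k + e \<le> d"
      by linarith
    then show ?case
    proof cases
      case 1
      then show ?thesis
        by (intro image_eqI[of _ _ "(0, d)"]) (auto simp: block_pos_def block_index_def)
    next
      \<comment> \<open>Here \<open>2 * d + 1\<close> is itself one of the moduli, which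
        \<open>e \<le> 1\<close> ensures at both ends of the range, so \<open>d\<close> paired with
        itself is forbidden.\<close>
      case 2
      then show ?thesis
        using add[OF less.prems less.prems] e by linarith
    next
      case 3
      then show ?thesis
        by (intro image_eqI[of _ _ "(1, d - (m + k + e))"])
          (auto simp: block_pos_def block_index_def)
    next
      \<comment> \<open>Now \<open>d\<close> is a modulus, which forces 0 into \<open>D\<close>; but
        \<open>d + 1\<close> is a modulus too, so \<open>d\<close> and 0 form a forbidden
        pair.\<close>
      case 4
      then have "d - d \<in> D"
        by (intro sub less.prems) auto
      then show ?thesis
        using add[OF less.prems, of 0] 4 by simp
    next
      case 5
      \<comment> \<open>Subtracting all moduli from \<open>d\<close> gives \<open>2 * k + 1\<close>
        consecutive elements of \<open>D\<close>, starting at \<open>c\<close>. By induction each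
        lies in some block.\<close>
      define c where "c = d - (2*m + 2*k + e)"
      have mem: "c + i \<in> block_pos m k e ` block_index m k" if "i \<le> 2 * k" for i
      proof -
        have ci: "c + i = d - (2*m + 2*k + e - i)"
          using 5 that by (simp add: c_def)
        have "c + i \<in> D"
          unfolding ci using 5 that by (intro sub less.prems) auto
        moreover have "c + i < d"
          using 5 that m by (simp add: c_def)
        ultimately show ?thesis
          using less.IH by blast
      qed
      obtain l j where lj: "(l, j) \<in> block_index m k" "c = block_pos m k e (l, j)"
        using mem[of 0] by auto
      have run: "(l, j + i) \<in> block_index m k \<and> c + i = block_pos m k e (l, j + i)"
        if "i \<le> 2 * k" for i
        using that
      proof (induction i)
        case 0
        then show ?case using lj by simp
      next
        case (Suc i)
        obtain l' j' where "(l', j') \<in> block_index m k" "c + Suc i = block_pos m k e (l', j')"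
          using mem[OF Suc.prems] by auto
        then show ?case
          using Suc block_pos_eqD[of l "j + i" m k l' j' e 1] k by auto
      qed
      \<comment> \<open>The last element of the run satisfies \<open>l * k + j + 2 * k < m\<close>,
        which is the condition for offset \<open>j\<close> to exist in block
        \<open>l + 2\<close>.\<close>
      have "(l + 2, j) \<in> block_index m k"
        using run[of "2 * k"] by (simp add: block_index_def algebra_simps)
      moreover have "d = block_pos m k e (l + 2, j)"
        unfolding block_pos_add2 using lj(2) 5 by (simp add: c_def)
      ultimately show ?thesis by blast
    qed
  qed
qed

text \<open>Blocks 0 and 1 lie below every modulus, so subtraction concerns higher blocks only.
  Among sums, two elements of block 0 give too little, while two of block 1, or anything with a
  higher block, give too much; only the mixed sums of blocks 0 and 1 remain.\<close>

lemma core_arms_block_pos_iff: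
  assumes k: "0 < k" and E: "E \<subseteq> block_index m k"
  shows "(\<forall>t\<in>{2*m + e..2*m + 2*k + e}. core_arms t (block_pos m k e ` E)) \<longleftrightarrow> admissible m k E"
proof
  let ?g = "block_pos m k e"
  assume core: "\<forall>t\<in>{2*m + e..2*m + 2*k + e}. core_arms t (?g ` E)"
  show "admissible m k E"
    unfolding admissible_def
  proof (intro conjI E allI impI notI)
    fix l j i assume lj: "(l + 2, j) \<in> E" and i: "i \<le> 2 * k"
    have "?g (l + 2, j) - (2*m + 2*k + e - i) = ?g (l, j + i)"
      unfolding block_pos_add2 using i by (simp add: block_pos_def)
    moreover have "?g (l + 2, j) - (2*m + 2*k + e - i) \<in> ?g ` E"
    proof -
      have "core_arms (2*m + 2*k + e - i) (?g ` E)" using core i by auto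
      moreover have "2*m + 2*k + e - i \<le> ?g (l + 2, j)"
        unfolding block_pos_add2 by simp
      ultimately show ?thesis
        using lj unfolding core_arms_def by blast
    qed
    ultimately have "?g (l, j + i) \<in> ?g ` E" by simp
    \<comment> \<open>Injectivity holds only on \<open>block_index m k\<close>, so the index must be
      known to lie there before membership is pulled back.\<close>
    moreover have "(l, j + i) \<in> block_index m k"
      using lj E i by (auto simp: block_index_def algebra_simps)
    ultimately show "(l, j + i) \<in> E"
      using inj_on_block_pos[OF k] E by (metis inj_on_image_mem_iff)
  next
    fix i j assume "(0, i) \<in> E" "(1, j) \<in> E" and ij: "m \<le> i + j + 1 + k \<and> i + j + 1 \<le> m + k"
    then have "core_arms t (?g ` E) \<Longrightarrow> ?g (0, i) + ?g (1, j) + 1 \<noteq> t" for t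
      unfolding core_arms_def by blast
    then show False
      using core ij by (fastforce simp: block_pos_def)
  qed
next
  let ?g = "block_pos m k e"
  assume adm: "admissible m k E"
  have low: "?g (0, j) < m" if "(0, j) \<in> E" for j
    using that E by (auto simp: block_pos_def block_index_def)
  have mid: "m + k + e \<le> ?g (1, j) \<and> ?g (1, j) < 2*m + e" if "(1, j) \<in> E" for j
    using that E by (auto simp: block_pos_def block_index_def)
  have high: "2*m + 2*k + e \<le> ?g (l + 2, j)" for l j
    unfolding block_pos_add2 by simp
  have cases2: "l = 0 \<or> l = 1 \<or> (\<exists>l'. l = l' + 2)" for l :: nat
    by presburger
  show "\<forall>t\<in>{2*m + e..2*m + 2*k + e}. core_arms t (?g ` E)"
  proof
    fix t assume t: "t \<in> {2*m + e..2*m + 2*k + e}"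
    have "?g (l, j) - t \<in> ?g ` E" if lj: "(l, j) \<in> E" "t \<le> ?g (l, j)" for l j
    proof -
      have "l \<noteq> 0" "l \<noteq> 1"
        using low[of j] mid[of j] t lj by - (rule notI, force)+
      then obtain l' where l': "l = l' + 2"
        using cases2[of l] by auto
      \<comment> \<open>The amount by which \<open>t\<close> falls short of the largest modulus
        becomes the shift of the offset.\<close>
      define i where "i = 2*m + 2*k + e - t"
      have "i \<le> 2 * k" using t by (auto simp: i_def)
      then have "(l', j + i) \<in> E"
        using adm lj l' by (auto simp: admissible_def)
      moreover have "?g (l, j) - t = ?g (l', j + i)"
        unfolding l' block_pos_add2 using t by (auto simp: i_def block_pos_def)
      ultimately show ?thesis by simp
    qed
    moreover have "?g (l, j) + ?g (l', j') + 1 \<noteq> t"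
      if "(l, j) \<in> E" "(l', j') \<in> E" for l j l' j'
    proof -
      have mixed: "?g (0, a) + ?g (1, b) + 1 \<noteq> t" if "(0, a) \<in> E" "(1, b) \<in> E" for a b
      proof -
        have "\<not> (m \<le> a + b + 1 + k \<and> a + b + 1 \<le> m + k)"
          using adm that by (auto simp: admissible_def)
        then show ?thesis
          using t by (auto simp: block_pos_def)
      qed
      consider "l = 0" "l' = 0" | "l = 0" "l' = 1" | "l = 1" "l' = 0" | "l = 1" "l' = 1"
        | "\<exists>a. l = a + 2" | "\<exists>a. l' = a + 2"
        using cases2[of l] cases2[of l'] by blast
      then show ?thesis
      proof cases
        case 1
        then show ?thesis using low[of j] low[of j'] that t by auto
      next
        case 2
        then show ?thesis using mixed that by auto
      next
        case 3
        then show ?thesis using mixed[of j' j] that by (simp add: add.commute)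
      next
        case 4
        then show ?thesis using mid[of j] mid[of j'] that t by auto
      next
        case 5
        then obtain a where "l = a + 2" ..
        then show ?thesis using high[of a j] t by simp
      next
        case 6
        then obtain a where "l' = a + 2" ..
        then show ?thesis using high[of a j'] t by simp
      qed
    qed
    ultimately show "core_arms t (?g ` E)"
      unfolding core_arms_def by fastforce
  qed
qed

text \<open>The set of admissible index sets is the same for \<open>e = 0\<close> and
  \<open>e = 1\<close>, so it serves as the common middle term between the two families of
  cores.\<close>

lemma self_conjugate_cores_eqpoll_admissible:
  assumes m: "0 < m" and k: "0 < k" and e: "e \<le> 1"
  shows "self_conjugate_cores {2*m + e..2*m + 2*k + e} \<approx> {E. admissible m k E}"
proof -
  let ?C = "{D. finite D \<and> (\<forall>t\<in>{2*m + e..2*m + 2*k + e}. core_arms t D)}"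
  have adm: "E \<subseteq> block_index m k" if "admissible m k E" for E
    using that by (simp add: admissible_def)
  have "bij_betw ((`) (block_pos m k e)) {E. admissible m k E} ?C"
  proof (rule bij_betw_imageI)
    show "inj_on ((`) (block_pos m k e)) {E. admissible m k E}"
      using adm inj_on_image_eq_iff[OF inj_on_block_pos[OF k]] by (auto intro!: inj_onI)
    show "(`) (block_pos m k e) ` {E. admissible m k E} = ?C"
    proof (intro equalityI subsetI)
      fix D assume "D \<in> (`) (block_pos m k e) ` {E. admissible m k E}"
      then obtain E where E: "admissible m k E" "D = block_pos m k e ` E" by auto
      moreover have "finite E"
        using adm[OF E(1)] finite_block_index[OF k] by (rule finite_subset)
      ultimately show "D \<in> ?C"
        using core_arms_block_pos_iff[OF k adm[OF E(1)], of e] by simp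
    next
      fix D assume D: "D \<in> ?C"
      then have "D \<subseteq> block_pos m k e ` block_index m k"
        using core_arms_subset_blocks[OF m k e] by simp
      then obtain E where "E \<subseteq> block_index m k" "D = block_pos m k e ` E"
        by (auto simp: subset_image_iff)
      then show "D \<in> (`) (block_pos m k e) ` {E. admissible m k E}"
        using D core_arms_block_pos_iff[OF k, of E m e] by auto
    qed
  qed
  then have "{E. admissible m k E} \<approx> ?C"
    by (auto simp: eqpoll_def)
  then show ?thesis
    using self_conjugate_cores_eqpoll[of "{2*m + e..2*m + 2*k + e}"] m
    by (auto intro: eqpoll_trans eqpoll_sym)
qed

theorem theorem2p9:
  fixes m k :: nat
  assumes "0 < m" and "0 < k"
  shows "self_conjugate_cores {2*m..2*m + 2*k} \<approx>
         self_conjugate_cores {2*m + 1..2*m + 2*k + 1}"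
  using self_conjugate_cores_eqpoll_admissible[OF assms, of 0]
    self_conjugate_cores_eqpoll_admissible[OF assms, of 1]
  by (auto intro: eqpoll_trans eqpoll_sym)

end
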